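(* Let $(X,\mathcal{B},\mu,T)$ be an aperiodic ergodic measure preserving system, and let $Z$ be the space of measurable functions $f:X\to\{0,1\}$ (modulo $\mu$-a.e. equality) with the $L_1(\mu)$-metric. Then for a generic set of $f\in Z$ (i.e. for all $f$ in some set containing a dense $G_\delta$ subset of $Z$) the stationary process $\{X_n\}_{n\in\mathbb{Z}}$ defined by $X_n(x)=f(T^nx)$ is not Rosenblatt mixing.
   Context: $(X,\mathcal{B},\mu)$ is a standard probability space and $T:X\to X$ is an invertible, $\mu$-preserving, ergodic transformation. Aperiodic means that the set of $T$-periodic points has measure zero. The space $Z$ with the $L_1$-metric is a complete separable metric space. A stationary process $\{X_n\}_{n\in\mathbb{Z}}$ is Rosenblatt mixing (also called $\alpha$-mixing) if $$\alpha(n)=\sup\{|\mathbb{P}(A\cap B)-\mathbb{P}(A)\mathbb{P}(B)| : A\in\mathcal{F}\{X_i:i<0\},\ B\in\mathcal{F}\{X_i:i\ge n\}\}$$ tends to $0$ as $n\to\infty$, where $\mathcal{F}\{\cdot\}$ denotes the $\sigma$-algebra generated by the indicated random variables. *)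

theory Defs
  imports "HOL-Probability.Probability"
begin

definition standard_borel :: "'a measure \<Rightarrow> bool" where
  "standard_borel M \<longleftrightarrow>
    (\<exists>X. completely_metrizable_space X \<and> second_countable X \<and> topspace X = space M \<and>
         sets M = sigma_sets (space M) {U. openin X U})"

text \<open>Both usual conventions are admitted: a Borel probability measure on a standard Borel space,
  and the completion of such a measure.\<close>

definition standard_prob_space :: "'a measure \<Rightarrow> bool" where
  "standard_prob_space M \<longleftrightarrow>
    prob_space M \<and> (\<exists>N. standard_borel N \<and> (M = N \<or> M = completion N))"

definition invertible_mpt :: "'a measure \<Rightarrow> ('a \<Rightarrow> 'a) \<Rightarrow> bool" where
  "invertible_mpt M T \<longleftrightarrow>
    bij_betw T (space M) (space M) \<and>
    T \<in> M \<rightarrow>\<^sub>M M \<and> the_inv_into (space M) T \<in> M \<rightarrow>\<^sub>M M \<and>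
    (\<forall>A\<in>sets M. emeasure M (T -` A \<inter> space M) = emeasure M A)"

definition ergodic :: "'a measure \<Rightarrow> ('a \<Rightarrow> 'a) \<Rightarrow> bool" where
  "ergodic M T \<longleftrightarrow>
    (\<forall>A\<in>sets M. T -` A \<inter> space M = A \<longrightarrow> emeasure M A = 0 \<or> emeasure M A = 1)"

definition aperiodic :: "'a measure \<Rightarrow> ('a \<Rightarrow> 'a) \<Rightarrow> bool" where
  "aperiodic M T \<longleftrightarrow> {x \<in> space M. \<exists>n>0. (T ^^ n) x = x} \<in> null_sets M"

definition int_iter :: "'a measure \<Rightarrow> ('a \<Rightarrow> 'a) \<Rightarrow> int \<Rightarrow> 'a \<Rightarrow> 'a" where
  "int_iter M T n =
    (if 0 \<le> n then T ^^ nat n else (the_inv_into (space M) T) ^^ nat (- n))"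

definition binary_funs :: "'a measure \<Rightarrow> ('a \<Rightarrow> real) set" where
  "binary_funs M = {f \<in> borel_measurable M. \<forall>x\<in>space M. f x \<in> {0, 1}}"

definition ae_equal :: "'a measure \<Rightarrow> (('a \<Rightarrow> real) \<times> ('a \<Rightarrow> real)) set" where
  "ae_equal M = {(f, g). f \<in> binary_funs M \<and> g \<in> binary_funs M \<and> (AE x in M. f x = g x)}"

definition Z_space :: "'a measure \<Rightarrow> ('a \<Rightarrow> real) set set" where
  "Z_space M = binary_funs M // ae_equal M"

text \<open>The distance of two classes is computed on chosen representatives; it does not depend on the
  choice, see \<open>Z_dist_class\<close> below.\<close>

definition Z_dist :: "'a measure \<Rightarrow> ('a \<Rightarrow> real) set \<Rightarrow> ('a \<Rightarrow> real) set \<Rightarrow> real" where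
  "Z_dist M \<phi> \<psi> = (LINT x|M. \<bar>(SOME f. f \<in> \<phi>) x - (SOME g. g \<in> \<psi>) x\<bar>)"

definition Z_topology :: "'a measure \<Rightarrow> ('a \<Rightarrow> real) set topology" where
  "Z_topology M = Metric_space.mtopology (Z_space M) (Z_dist M)"

definition generic_in :: "'b topology \<Rightarrow> 'b set \<Rightarrow> bool" where
  "generic_in X S \<longleftrightarrow>
    (\<exists>G. gdelta_in X G \<and> X closure_of G = topspace X \<and> G \<subseteq> S)"

definition generated_sigma ::
    "'a measure \<Rightarrow> ('i \<Rightarrow> 'a \<Rightarrow> real) \<Rightarrow> 'i set \<Rightarrow> 'a set set" where
  "generated_sigma M X I =
    sigma_sets (space M) (\<Union>i\<in>I. {X i -` S \<inter> space M | S. S \<in> sets borel})"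

definition rosenblatt_alpha :: "'a measure \<Rightarrow> (int \<Rightarrow> 'a \<Rightarrow> real) \<Rightarrow> nat \<Rightarrow> real" where
  "rosenblatt_alpha M X n =
    Sup {\<bar>measure M (A \<inter> B) - measure M A * measure M B\<bar> | A B.
           A \<in> generated_sigma M X {i. i < 0} \<and> B \<in> generated_sigma M X {i. int n \<le> i}}"

definition rosenblatt_mixing :: "'a measure \<Rightarrow> (int \<Rightarrow> 'a \<Rightarrow> real) \<Rightarrow> bool" where
  "rosenblatt_mixing M X \<longleftrightarrow> rosenblatt_alpha M X \<longlonglongrightarrow> 0"

definition orbit_process ::
    "'a measure \<Rightarrow> ('a \<Rightarrow> 'a) \<Rightarrow> ('a \<Rightarrow> real) \<Rightarrow> int \<Rightarrow> 'a \<Rightarrow> real" where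
  "orbit_process M T f n x = f (int_iter M T n x)"

definition stationary_process :: "'a measure \<Rightarrow> (int \<Rightarrow> 'a \<Rightarrow> real) \<Rightarrow> bool" where
  "stationary_process M X \<longleftrightarrow>
    (\<forall>i. X i \<in> borel_measurable M) \<and>
    (\<forall>k. distr M (\<Pi>\<^sub>M i\<in>UNIV. borel) (\<lambda>x i. X (i + k) x) =
         distr M (\<Pi>\<^sub>M i\<in>UNIV. borel) (\<lambda>x i. X i x))"

lemma equiv_ae_equal: "equiv (binary_funs M) (ae_equal M)"
proof (rule equivI)
  show "ae_equal M \<subseteq> binary_funs M \<times> binary_funs M"
    by (auto simp: ae_equal_def)
  show "refl_on (binary_funs M) (ae_equal M)"
    by (auto simp: refl_on_def ae_equal_def)
  show "sym (ae_equal M)"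
    by (auto simp: sym_def ae_equal_def elim: eventually_mono)
  show "trans (ae_equal M)"
    unfolding trans_def ae_equal_def by (auto elim: eventually_elim2)
qed

lemma Z_space_some:
  assumes "\<phi> \<in> Z_space M"
  shows "(SOME f. f \<in> \<phi>) \<in> \<phi>" "\<phi> \<subseteq> binary_funs M"
  using assms equiv_ae_equal[of M] in_quotient_imp_non_empty in_quotient_imp_subset some_in_eq
  unfolding Z_space_def by metis+

lemma Z_space_AE:
  assumes "\<phi> \<in> Z_space M" "f \<in> \<phi>" "g \<in> \<phi>"
  shows "AE x in M. f x = g x"
  using in_quotient_imp_in_rel[OF equiv_ae_equal, of \<phi> M f g] assms
  by (auto simp: Z_space_def ae_equal_def)

lemma Z_dist_class:
  assumes "\<phi> \<in> Z_space M" "\<psi> \<in> Z_space M" "f \<in> \<phi>" "g \<in> \<psi>"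
  shows "Z_dist M \<phi> \<psi> = (LINT x|M. \<bar>f x - g x\<bar>)"
  unfolding Z_dist_def
proof (rule integral_cong_AE)
  note s = Z_space_some[OF assms(1)] Z_space_some[OF assms(2)]
  have m: "(SOME f. f \<in> \<phi>) \<in> borel_measurable M" "(SOME f. f \<in> \<psi>) \<in> borel_measurable M"
    "f \<in> borel_measurable M" "g \<in> borel_measurable M"
    using s assms by (auto simp: binary_funs_def)
  show "(\<lambda>x. \<bar>(SOME f. f \<in> \<phi>) x - (SOME g. g \<in> \<psi>) x\<bar>) \<in> borel_measurable M"
    "(\<lambda>x. \<bar>f x - g x\<bar>) \<in> borel_measurable M"
    using m by measurable
  show "AE x in M. \<bar>(SOME f. f \<in> \<phi>) x - (SOME g. g \<in> \<psi>) x\<bar> = \<bar>f x - g x\<bar>"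
    using Z_space_AE[OF assms(1) s(1) assms(3)] Z_space_AE[OF assms(2) s(3) assms(4)]
    by eventually_elim simp
qed

lemma Z_metric:
  assumes "prob_space M"
  shows "Metric_space (Z_space M) (Z_dist M)"
proof -
  interpret prob_space M by fact
  have int: "integrable M (\<lambda>x. \<bar>f x - g x\<bar>)"
    if "f \<in> binary_funs M" "g \<in> binary_funs M" for f g
    using that
    by (intro integrable_const_bound[of _ 1]) (fastforce simp: binary_funs_def)+
  show ?thesis
  proof
    show "0 \<le> Z_dist M \<phi> \<psi>" for \<phi> \<psi>
      by (simp add: Z_dist_def)
    show "Z_dist M \<phi> \<psi> = Z_dist M \<psi> \<phi>" for \<phi> \<psi>
      by (simp add: Z_dist_def abs_minus_commute)
  next
    fix \<phi> \<psi> assume pq: "\<phi> \<in> Z_space M" "\<psi> \<in> Z_space M"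
    obtain f g where fg: "f \<in> \<phi>" "g \<in> \<psi>"
      using Z_space_some(1) pq by blast
    then have F: "f \<in> binary_funs M" "g \<in> binary_funs M"
      using Z_space_some(2) pq by blast+
    have "Z_dist M \<phi> \<psi> = 0 \<longleftrightarrow> (AE x in M. \<bar>f x - g x\<bar> = 0)"
      unfolding Z_dist_class[OF pq fg]
      by (intro integral_nonneg_eq_0_iff_AE int F) auto
    also have "\<dots> \<longleftrightarrow> (f, g) \<in> ae_equal M"
      using F by (simp add: ae_equal_def)
    also have "\<dots> \<longleftrightarrow> \<phi> = \<psi>"
      using quotient_eq_iff[OF equiv_ae_equal, of \<phi> M \<psi> f g] pq fg by (simp add: Z_space_def)
    finally show "Z_dist M \<phi> \<psi> = 0 \<longleftrightarrow> \<phi> = \<psi>" .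
  next
    fix \<phi> \<psi> \<theta> assume pq: "\<phi> \<in> Z_space M" "\<psi> \<in> Z_space M" "\<theta> \<in> Z_space M"
    obtain f g h where fg: "f \<in> \<phi>" "g \<in> \<psi>" "h \<in> \<theta>"
      using Z_space_some(1) pq by blast
    then have F: "f \<in> binary_funs M" "g \<in> binary_funs M" "h \<in> binary_funs M"
      using Z_space_some(2) pq by blast+
    have "(LINT x|M. \<bar>f x - h x\<bar>) \<le> (LINT x|M. \<bar>f x - g x\<bar> + \<bar>g x - h x\<bar>)"
      by (intro integral_mono Bochner_Integration.integrable_add int F) auto
    also have "\<dots> = (LINT x|M. \<bar>f x - g x\<bar>) + (LINT x|M. \<bar>g x - h x\<bar>)"
      by (intro Bochner_Integration.integral_add int F)
    finally show "Z_dist M \<phi> \<theta> \<le> Z_dist M \<phi> \<psi> + Z_dist M \<psi> \<theta>"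
      using pq fg by (simp add: Z_dist_class)
  qed
qed

lemma int_iter_measurable:
  assumes "invertible_mpt M T"
  shows "int_iter M T n \<in> M \<rightarrow>\<^sub>M M"
  using assms measurable_compose_n[of T M] measurable_compose_n[of "the_inv_into (space M) T" M]
  by (auto simp: int_iter_def invertible_mpt_def)

lemma int_iter_add_one:
  assumes "invertible_mpt M T" "x \<in> space M"
  shows "int_iter M T (n + 1) x = int_iter M T n (T x)"
proof (cases "0 \<le> n")
  case True
  then show ?thesis
    by (simp add: int_iter_def nat_add_distrib funpow_swap1)
next
  case False
  define k where "k = nat (- n - 1)"
  have n: "n = - int k - 1" "nat (- n) = Suc k"
    using False by (auto simp: k_def)
  have inj: "inj_on T (space M)"
    using assms by (auto simp: invertible_mpt_def bij_betw_def)
  show ?thesis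
    using assms(2) the_inv_into_f_f[OF inj assms(2)] False n
    by (auto simp: int_iter_def funpow_swap1)
qed

lemma stationary_orbit_process:
  assumes T: "invertible_mpt M T" and f: "f \<in> binary_funs M"
  shows "stationary_process M (orbit_process M T f)"
proof -
  let ?P = "\<Pi>\<^sub>M i\<in>(UNIV :: int set). (borel :: real measure)"
  define X where "X = orbit_process M T f"
  define L where "L k = distr M ?P (\<lambda>x i. X (i + k) x)" for k
  have mX: "X i \<in> borel_measurable M" for i
    unfolding X_def orbit_process_def[abs_def]
    using f by (intro measurable_compose[OF int_iter_measurable[OF T]]) (auto simp: binary_funs_def)
  have mL: "(\<lambda>x i. X (i + k) x) \<in> M \<rightarrow>\<^sub>M ?P" for k
    by (rule measurable_PiM_single') (use mX in auto)
  have mT: "T \<in> M \<rightarrow>\<^sub>M M" and dT: "distr M M T = M"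
    using T by (auto simp: invertible_mpt_def intro!: measure_eqI simp: emeasure_distr)
  have step: "L (k + 1) = L k" for k
  proof -
    have "L (k + 1) = distr M ?P ((\<lambda>x i. X (i + k) x) \<circ> T)"
      unfolding L_def
    proof (rule distr_cong)
      fix x assume x: "x \<in> space M"
      have "X (i + (k + 1)) x = X (i + k) (T x)" for i
        using int_iter_add_one[OF T x, of "i + k"]
        by (simp add: X_def orbit_process_def add.assoc)
      then show "(\<lambda>i. X (i + (k + 1)) x) = ((\<lambda>x i. X (i + k) x) \<circ> T) x"
        by simp
    qed auto
    also have "\<dots> = distr (distr M M T) ?P (\<lambda>x i. X (i + k) x)"
      by (rule distr_distr[symmetric, OF mL mT])
    finally show ?thesis
      by (simp add: dT L_def)
  qed
  have "L k = L 0" for k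
  proof (induction k rule: int_induct[where k = 0])
    case (step2 i)
    then show ?case using step[of "i - 1"] by simp
  qed (simp_all add: step)
  then show ?thesis
    using mX by (simp add: stationary_process_def L_def X_def)
qed

end

theory Submission
  imports Defs
begin

text \<open>
  Let \<open>W n\<close> be the set of classes with \<open>\<alpha>(n) \<ge> 1/128\<close>. The process is not mixing on
  \<open>\<Inter>n. interior (W n)\<close>, so by Baire it suffices that each of these interiors is dense. Given \<open>f\<close>,
  choose a set \<open>F\<close> whose first \<open>N\<close> iterates are disjoint and with \<open>\<mu>(F) \<ge> 1/(2N)\<close>, and modify \<open>f\<close> on
  a set of small measure such that a run of \<open>m\<close> ones starts at a point exactly when the point is in
  \<open>F\<close>. Let \<open>A\<close> say that such a run starts at some time in \<open>[-p, -m]\<close>, and \<open>B\<close> that one starts at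
  some time in \<open>[n, q]\<close>, where \<open>p\<close> and \<open>q\<close> are about \<open>N/2\<close> and \<open>p + q < N\<close>. Then \<open>A\<close> and \<open>B\<close> are
  disjoint and each has probability at least \<open>1/8\<close>. Both depend on finitely many coordinates, so
  their dependence persists under small \<open>L\<^sub>1\<close> perturbations.\<close>

subsection \<open>The group of iterates\<close>

locale invertible_system = prob_space M for M :: "'a measure" +
  fixes T :: "'a \<Rightarrow> 'a"
  assumes mpt: "invertible_mpt M T"
begin

abbreviation S :: "int \<Rightarrow> 'a \<Rightarrow> 'a" where "S \<equiv> int_iter M T"

lemma S_measurable [measurable]: "S k \<in> M \<rightarrow>\<^sub>M M"
  using int_iter_measurable[OF mpt] .

lemma S_space [simp]: "x \<in> space M \<Longrightarrow> S k x \<in> space M"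
  using measurable_space[OF S_measurable] .

lemma S_0 [simp]: "S 0 x = x"
  by (simp add: int_iter_def)

lemma S_of_nat: "S (int n) = T ^^ n"
  by (simp add: int_iter_def)

text \<open>\<open>int_iter_add_one\<close> splits off \<open>T\<close> on the inside, so the
  induction on \<open>b\<close> keeps \<open>x\<close> arbitrary; its downward step uses that
  \<open>T\<close> is onto.\<close>

lemma S_add:
  assumes "x \<in> space M"
  shows "S (a + b) x = S a (S b x)"
  using assms
proof (induction b arbitrary: x rule: int_induct[where k = 0])
  case base
  then show ?case by simp
next
  case (step1 i)
  have "T x \<in> space M"
    using step1(3) mpt by (auto simp: invertible_mpt_def bij_betw_def)
  then show ?case
    using step1 int_iter_add_one[OF mpt step1(3), of "a + i"] int_iter_add_one[OF mpt step1(3), of i]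
    by (simp add: add.assoc)
next
  case (step2 i)
  obtain y where y: "y \<in> space M" "x = T y"
    using mpt step2(3) by (auto simp: invertible_mpt_def bij_betw_def)
  have "S (a + (i - 1)) (T y) = S (a + i) y"
    using int_iter_add_one[OF mpt y(1), of "a + (i - 1)"] by simp
  also have "\<dots> = S a (S (i - 1) (T y))"
    using step2.IH[OF y(1)] int_iter_add_one[OF mpt y(1), of "i - 1"] by simp
  finally show ?case
    using y by simp
qed

lemma S_S: "x \<in> space M \<Longrightarrow> S a (S b x) = S (a + b) x"
  by (simp add: S_add)

lemma distr_S: "distr M M (S k) = M"
proof -
  have mT: "T \<in> M \<rightarrow>\<^sub>M M" and dT: "distr M M T = M"
    using mpt by (auto simp: invertible_mpt_def intro!: measure_eqI simp: emeasure_distr)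
  have step: "distr M M (S (k + 1)) = distr M M (S k)" for k
  proof -
    have "distr M M (S (k + 1)) = distr M M (S k \<circ> T)"
      using int_iter_add_one[OF mpt] by (intro distr_cong) auto
    also have "\<dots> = distr (distr M M T) M (S k)"
      by (rule distr_distr[symmetric, OF S_measurable mT])
    finally show ?thesis by (simp add: dT)
  qed
  have S0: "S 0 = (\<lambda>x. x)"
    by auto
  show ?thesis
  proof (induction k rule: int_induct[where k = 0])
    case (step2 i)
    then show ?case using step[of "i - 1"] by simp
  qed (simp_all add: step distr_id2 S0)
qed

lemma prob_S: "A \<in> events \<Longrightarrow> prob {x \<in> space M. S k x \<in> A} = prob A"
  using measure_distr[OF S_measurable, of A k]
  by (simp add: distr_S vimage_def Int_def conj_commute)

lemma AE_S:
  assumes "AE x in M. P x"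
  shows "AE x in M. P (S k x)"
  using assms by (intro AE_distrD[OF S_measurable]) (subst distr_S)

lemma prob_visit_le:
  assumes "A \<in> events" "finite K"
  shows "prob {x \<in> space M. \<exists>k\<in>K. S k x \<in> A} \<le> card K * prob A"
proof -
  have "{x \<in> space M. \<exists>k\<in>K. S k x \<in> A} = (\<Union>k\<in>K. {x \<in> space M. S k x \<in> A})"
    by auto
  also have "prob \<dots> \<le> (\<Sum>k\<in>K. prob {x \<in> space M. S k x \<in> A})"
    using assms by (intro measure_UNION_le) auto
  finally show ?thesis
    using assms by (simp add: prob_S)
qed

subsection \<open>Marker sets\<close>

text \<open>For \<open>A\<close> inside the space: the first \<open>N\<close> iterates of
  \<open>A\<close> are pairwise disjoint, so \<open>A\<close> is the base of a Rokhlin tower of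
  height \<open>N\<close>.\<close>

definition separated :: "nat \<Rightarrow> 'a set \<Rightarrow> bool" where
  "separated N A \<longleftrightarrow> (\<forall>x\<in>A. \<forall>i. 0 < i \<and> i < int N \<longrightarrow> S i x \<notin> A)"

lemma separatedD: "separated N A \<Longrightarrow> x \<in> A \<Longrightarrow> 0 < i \<Longrightarrow> i < int N \<Longrightarrow> S i x \<notin> A"
  by (auto simp: separated_def)

text \<open>Two visits at times in \<open>K\<close> would be less than \<open>N\<close> apart, which
  separation forbids; hence the union bound is an equality.\<close>

lemma prob_visit_separated:
  assumes A: "A \<in> events" "separated N A" and K: "finite K"
    and diff: "\<And>k l. k \<in> K \<Longrightarrow> l \<in> K \<Longrightarrow> k - l < int N"
  shows "prob {x \<in> space M. \<exists>k\<in>K. S k x \<in> A} = card K * prob A"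
proof -
  have *: False if "k \<in> K" "l \<in> K" "l < k" "x \<in> space M" "S k x \<in> A" "S l x \<in> A" for k l x
    using separatedD[OF A(2) that(6), of "k - l"] diff[OF that(1,2)] that by (simp add: S_S)
  have "{x \<in> space M. \<exists>k\<in>K. S k x \<in> A} = (\<Union>k\<in>K. {x \<in> space M. S k x \<in> A})"
    by auto
  also have "prob \<dots> = (\<Sum>k\<in>K. prob {x \<in> space M. S k x \<in> A})"
  proof (rule finite_measure_finite_Union)
    show "disjoint_family_on (\<lambda>k. {x \<in> space M. S k x \<in> A}) K"
      unfolding disjoint_family_on_def
    proof (intro ballI impI)
      fix k l assume "k \<in> K" "l \<in> K" "k \<noteq> l"
      then show "{x \<in> space M. S k x \<in> A} \<inter> {x \<in> space M. S l x \<in> A} = {}"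
        using *[of k l] *[of l k] by (cases "k < l") auto
    qed
  qed (use A K in auto)
  finally show ?thesis
    using A by (simp add: prob_S)
qed

text \<open>A weak Rokhlin lemma by a greedy construction. Finite intersections of members of
  \<open>C\<close> distinguish an aperiodic point from its next \<open>N - 1\<close> iterates, so
  countably many separated sets \<open>E k\<close> cover almost every point; they are merged one
  after the other.\<close>

lemma marker_set:
  assumes C: "countable C" "C \<subseteq> sets M"
      "\<And>x y. x \<in> space M \<Longrightarrow> y \<in> space M \<Longrightarrow> x \<noteq> y \<Longrightarrow> \<exists>U\<in>C. x \<in> U \<and> y \<notin> U"
    and ap: "aperiodic M T" and N: "0 < N"
  obtains F where "F \<in> events" "separated N F" "AE x in M. \<exists>i. \<bar>i\<bar> < int N \<and> S i x \<in> F"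
proof -
  define B where "B V = {x \<in> space M. \<forall>U\<in>V. x \<in> U}" for V
  define Vs where "Vs = {V. finite V \<and> V \<subseteq> C}"
  have Vs: "countable Vs" "Vs \<noteq> {}"
    using countable_Collect_finite_subset[OF C(1)] by (auto simp: Vs_def)
  \<comment> \<open>The points of one finite intersection that do not return to it before time
    \<open>N\<close>.\<close>
  define E where "E k = {x \<in> B (from_nat_into Vs k). \<forall>i\<in>{0<..<int N}. S i x \<notin> B (from_nat_into Vs k)}" for k
  have B_sets: "B V \<in> events" if "V \<in> Vs" for V
  proof -
    have "B V = space M \<inter> (\<Inter>U\<in>V. space M \<inter> U)"
      by (auto simp: B_def)
    moreover have "(\<Inter>U\<in>V. space M \<inter> U) \<in> events" if "V \<noteq> {}"
      using \<open>V \<in> Vs\<close> C(2) that by (intro sets.finite_INT) (auto simp: Vs_def)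
    ultimately show ?thesis
      by (cases "V = {}") auto
  qed
  have fV: "from_nat_into Vs k \<in> Vs" for k
    using from_nat_into[OF Vs(2)] .
  have E_sets [measurable]: "E k \<in> events" for k
  proof -
    note [measurable] = B_sets[OF fV, of k]
    have "E k = {x \<in> space M. x \<in> B (from_nat_into Vs k) \<and> (\<forall>i\<in>{0<..<int N}. S i x \<notin> B (from_nat_into Vs k))}"
      by (auto simp: E_def B_def)
    also have "\<dots> \<in> events" by measurable
    finally show ?thesis .
  qed
  have E_space: "x \<in> space M" if "x \<in> E k" for x k
    using that by (auto simp: E_def B_def)
  have E_sep: "separated N (E k)" for k
    by (auto simp: separated_def E_def)
  \<comment> \<open>Stage \<open>k\<close> adds those points of \<open>E k\<close> that have no
    earlier chosen point within \<open>N - 1\<close> steps, forward or backward.\<close>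
  define G where "G = rec_nat {} (\<lambda>k A. A \<union> {x \<in> E k. \<forall>i. \<bar>i\<bar> < int N \<longrightarrow> S i x \<notin> A})"
  have G_0: "G 0 = {}" and G_Suc: "G (Suc k) = G k \<union> {x \<in> E k. \<forall>i. \<bar>i\<bar> < int N \<longrightarrow> S i x \<notin> G k}" for k
    by (simp_all add: G_def)
  have G_sets: "G k \<in> events" for k
  proof (induction k)
    case (Suc k)
    note [measurable] = Suc
    have "{x \<in> E k. \<forall>i. \<bar>i\<bar> < int N \<longrightarrow> S i x \<notin> G k}
        = {x \<in> space M. x \<in> E k \<and> (\<forall>i. \<bar>i\<bar> < int N \<longrightarrow> S i x \<notin> G k)}"
      using E_space by auto
    also have "\<dots> \<in> events" by measurable
    finally show ?case using Suc by (simp add: G_Suc)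
  qed (simp add: G_0)
  have G_mono: "mono G"
    by (rule incseq_SucI) (auto simp: G_Suc)
  have G_sep: "separated N (G k)" for k
  proof (induction k)
    case (Suc k)
    show ?case unfolding separated_def
    proof (intro ballI allI impI notI)
      fix x i assume x: "x \<in> G (Suc k)" and i: "0 < i \<and> i < int N" and Six: "S i x \<in> G (Suc k)"
      have xs: "x \<in> space M"
        using x sets.sets_into_space[OF G_sets] by auto
      \<comment> \<open>Two new points both lie in the separated set \<open>E k\<close>; an old and
        a new point are kept apart by the choice of the new one.\<close>
      consider "x \<in> G k" "S i x \<in> G k" | "x \<in> E k" "S i x \<in> E k"
        | "x \<in> G k" "\<forall>j. \<bar>j\<bar> < int N \<longrightarrow> S j (S i x) \<notin> G k"
        | "S i x \<in> G k" "\<forall>j. \<bar>j\<bar> < int N \<longrightarrow> S j x \<notin> G k"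
        using x Six by (auto simp: G_Suc)
      then show False
      proof cases
        case 1 then show ?thesis using Suc i by (auto simp: separated_def)
      next
        case 2 then show ?thesis using E_sep i by (auto simp: separated_def)
      next
        case 3 then show ?thesis using i xs by (auto simp: S_S dest: spec[of _ "- i"])
      next
        case 4 then show ?thesis using i by (auto dest: spec[of _ i])
      qed
    qed
  qed (simp add: separated_def G_0)
  define F where "F = (\<Union>k. G k)"
  show ?thesis
  proof
    show "F \<in> events"
      using G_sets by (auto simp: F_def)
    show "separated N F"
      unfolding separated_def F_def
    proof (intro ballI allI impI notI)
      fix x i assume "x \<in> (\<Union>k. G k)" "0 < i \<and> i < int N" "S i x \<in> (\<Union>k. G k)"
      then obtain k l where kl: "x \<in> G k" "S i x \<in> G l" by auto
      have "x \<in> G (max k l)" "S i x \<in> G (max k l)"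
        using kl monoD[OF G_mono, of k "max k l"] monoD[OF G_mono, of l "max k l"] by auto
      then show False
        using separatedD[OF G_sep] \<open>0 < i \<and> i < int N\<close> by blast
    qed
    have "AE x in M. \<not> (\<exists>n>0. (T ^^ n) x = x)"
      using AE_not_in[OF ap[unfolded aperiodic_def]] AE_space by eventually_elim auto
    then show "AE x in M. \<exists>i. \<bar>i\<bar> < int N \<and> S i x \<in> F"
      using AE_space
    proof eventually_elim
      case (elim x)
      \<comment> \<open>A return at time \<open>i\<close> would make \<open>x\<close> periodic. The
        finitely many separating sets then determine an index \<open>k\<close> with \<open>x\<close>
        in \<open>E k\<close>.\<close>
      have "\<exists>U\<in>C. x \<in> U \<and> S i x \<notin> U" if "i \<in> {0<..<int N}" for i
      proof (rule C(3))
        show "x \<noteq> S i x"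
          using elim(1) that S_of_nat[of "nat i"] by (metis greaterThanLessThan_iff int_nat_eq less_le_not_le zero_less_nat_eq)
      qed (use elim in auto)
      then obtain u where u: "\<And>i. i \<in> {0<..<int N} \<Longrightarrow> u i \<in> C \<and> x \<in> u i \<and> S i x \<notin> u i"
        by metis
      define V where "V = u ` {0<..<int N}"
      have "V \<in> Vs"
        using u by (auto simp: V_def Vs_def)
      then obtain k where k: "from_nat_into Vs k = V"
        using from_nat_into_surj[OF Vs(1)] by metis
      have xE: "x \<in> E k"
        using u elim(2) unfolding E_def k B_def V_def by (force intro: bexI)
      \<comment> \<open>Either an already chosen point is near, or \<open>x\<close> itself is chosen
        at stage \<open>k\<close> and the time \<open>0\<close> serves.\<close>
      show ?case
      proof (cases "\<exists>i. \<bar>i\<bar> < int N \<and> S i x \<in> G k")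
        case True
        then show ?thesis by (auto simp: F_def)
      next
        case False
        then have "x \<in> G (Suc k)"
          using xE by (auto simp: G_Suc)
        moreover have "0 < int N"
          using N by simp
        ultimately show ?thesis
          by (intro exI[of _ 0]) (auto simp: F_def)
      qed
    qed
  qed
qed

text \<open>Almost every point visits \<open>F\<close> at one of \<open>2 * N - 1\<close> times,
  each visit having probability \<open>prob F\<close>.\<close>

lemma prob_marker_ge:
  assumes F: "F \<in> events" "AE x in M. \<exists>i. \<bar>i\<bar> < int N \<and> S i x \<in> F" and N: "0 < N"
  shows "1 / (2 * N) \<le> prob F"
proof -
  have "AE x in M. x \<in> {x \<in> space M. \<exists>i\<in>{- int N<..<int N}. S i x \<in> F}"
    using F(2) AE_space by eventually_elim (auto simp: abs_less_iff)
  then have "1 = prob {x \<in> space M. \<exists>i\<in>{- int N<..<int N}. S i x \<in> F}"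
    using F(1) by (subst (asm) AE_in_set_eq_1) auto
  also have "\<dots> \<le> card {- int N<..<int N} * prob F"
    using F(1) by (intro prob_visit_le) auto
  also have "\<dots> \<le> (2 * N) * prob F"
    by (intro mult_right_mono) auto
  finally show ?thesis
    using N by (simp add: field_simps)
qed

text \<open>Visits to \<open>F\<close> at the times \<open>0\<close>, ..., \<open>N - 1\<close> are
  disjoint events of equal probability.\<close>

lemma prob_separated_le:
  assumes "F \<in> events" "separated N F" "0 < N"
  shows "prob F \<le> 1 / N"
proof -
  have "prob {x \<in> space M. \<exists>k\<in>{0..<int N}. S k x \<in> F} = card {0..<int N} * prob F"
    using assms by (intro prob_visit_separated) auto
  then have "N * prob F \<le> 1"
    using prob_le_1[of "{x \<in> space M. \<exists>k\<in>{0..<int N}. S k x \<in> F}"] by simp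
  then show ?thesis
    using assms(3) by (simp add: field_simps)
qed

section \<open>Encoding a marker set by runs of ones\<close>

text \<open>Writing \<open>r x\<close> for the time elapsed since the last visit of \<open>x\<close> to \<open>F\<close>, the new function is
  \<open>1\<close> where \<open>r x < m\<close>, and it is \<open>0\<close> where \<open>r x = m\<close>, along one residue class of \<open>r x\<close> modulo \<open>m\<close>
  (chosen by pigeonhole to have measure at most \<open>1 / m\<close>), and just before each visit to \<open>F\<close>.
  These zeros destroy every other run of \<open>m\<close> ones.\<close>

lemma encode_marker:
  fixes m :: nat
  assumes F: "F \<in> events" "separated N F" "AE x in M. \<exists>i. \<bar>i\<bar> < int N \<and> S i x \<in> F"
    and f: "f \<in> binary_funs M" and m: "0 < m" "m < N"
  obtains g where "g \<in> binary_funs M"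
    "\<And>x. x \<in> space M \<Longrightarrow> (\<forall>j<m. g (S (int j) x) = 1) \<longleftrightarrow> x \<in> F"
    "prob {x \<in> space M. f x \<noteq> g x} \<le> (m + 2) / N + 1 / m"
proof -
  have [measurable]: "F \<in> events" by fact
  have [measurable]: "f \<in> borel_measurable M" and f01: "\<And>x. x \<in> space M \<Longrightarrow> f x \<in> {0, 1}"
    using f by (auto simp: binary_funs_def)
  define visited where "visited x \<longleftrightarrow> (\<exists>k::nat. S (- int k) x \<in> F)" for x
  define r where "r x = (LEAST k::nat. S (- int k) x \<in> F)" for x
  have [measurable]: "Measurable.pred M visited"
    unfolding visited_def[abs_def] by measurable
  have r_meas [measurable]: "r \<in> M \<rightarrow>\<^sub>M count_space UNIV"
    unfolding r_def[abs_def] by measurable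
  have r_visit: "S (- int (r x)) x \<in> F" if "visited x" for x
    using that unfolding visited_def r_def by (rule LeastI_ex)
  have r_le: "visited x \<and> r x \<le> k" if "S (- int k) x \<in> F" for x k
    using that unfolding visited_def r_def by (auto intro: Least_le)
  \<comment> \<open>The clock \<open>r\<close> advances by one per step as long as \<open>F\<close>
    is not entered.\<close>
  have r_step: "visited (S (int i) x) \<and> r (S (int i) x) = r x + i"
    if x: "x \<in> space M" "visited x" and no: "\<And>l. 1 \<le> l \<Longrightarrow> l \<le> i \<Longrightarrow> S (int l) x \<notin> F" for x i
  proof
    have *: "S (- int (r x + i)) (S (int i) x) \<in> F"
      using r_visit[OF x(2)] x(1) by (simp add: S_S)
    then show "visited (S (int i) x)"
      using r_le by blast
    show "r (S (int i) x) = r x + i"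
      unfolding r_def[of "S (int i) x"]
    proof (rule Least_equality)
      show "S (- int (r x + i)) (S (int i) x) \<in> F" by (fact *)
      fix k assume "S (- int k) (S (int i) x) \<in> F"
      then have k: "S (int i - int k) x \<in> F"
        using x(1) by (simp add: S_S)
      have "i \<le> k"
        using no[of "i - k"] k by (cases "k < i") (auto simp: of_nat_diff Suc_le_eq)
      then have "S (- int (k - i)) x \<in> F"
        using k by (simp add: of_nat_diff)
      then show "r x + i \<le> k"
        using r_le[of "k - i" x] \<open>i \<le> k\<close> by linarith
    qed
  qed
  \<comment> \<open>The most recent visit and the visit at time \<open>i\<close> are
    \<open>r x + i\<close> steps apart, which separation makes at least \<open>N\<close>.\<close>
  have gap: "N \<le> r x + i" if "x \<in> space M" "visited x" "S (int i) x \<in> F" "1 \<le> i" for x i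
  proof (rule ccontr)
    assume "\<not> N \<le> r x + i"
    then have "S (int (r x + i)) (S (- int (r x)) x) \<notin> F"
      using that r_visit[of x] by (intro separatedD[OF F(2)]) auto
    then show False
      using that by (simp add: S_S)
  qed

  define D where "D t = {x \<in> space M. r x mod m = t}" for t
  have D_sets [measurable]: "D t \<in> events" for t
    unfolding D_def by measurable
  have "\<exists>t<m. prob (D t) \<le> 1 / m"
  proof (rule ccontr)
    assume "\<not> ?thesis"
    then have gt: "1 / m < prob (D t)" if "t < m" for t
      using that by (auto simp: not_le)
    have "1 = (\<Sum>t<m. 1 / real m)"
      using m by simp
    also have "\<dots> < (\<Sum>t<m. prob (D t))"
      using m gt by (intro sum_strict_mono) auto
    also have "\<dots> = prob (\<Union>t<m. D t)"
      by (rule finite_measure_finite_Union[symmetric]) (auto simp: disjoint_family_on_def D_def)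
    also have "\<dots> \<le> 1"
      by (rule prob_le_1)
    finally show False by simp
  qed
  then obtain t where t: "t < m" "prob (D t) \<le> 1 / m" by blast

  \<comment> \<open>The clause \<open>r x < m\<close> never overrides the zero before a visit, since
    there \<open>gap\<close> gives \<open>r x \<ge> N - 1 \<ge> m\<close>. Points without a past
    visit form a null set and get the default \<open>0\<close>.\<close>
  define g :: "'a \<Rightarrow> real" where "g x = (if visited x then
      if r x < m then 1 else if r x = m \<or> r x mod m = t \<or> S 1 x \<in> F then 0 else f x else 0)" for x
  show ?thesis
  proof
    show "g \<in> binary_funs M"
      unfolding binary_funs_def
    proof (intro CollectI conjI ballI)
      show "g \<in> borel_measurable M"
        unfolding g_def[abs_def] by measurable
    qed (use f01 in \<open>auto simp: g_def\<close>)
  next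
    fix x assume x: "x \<in> space M"
    show "(\<forall>j<m. g (S (int j) x) = 1) \<longleftrightarrow> x \<in> F"
    proof
      assume "x \<in> F"
      then have vis: "visited x" and r0: "r x = 0"
        using r_le[of 0 x] by auto
      show "\<forall>j<m. g (S (int j) x) = 1"
      proof (intro allI impI)
        fix j assume "j < m"
        then have "visited (S (int j) x) \<and> r (S (int j) x) = r x + j"
          using m separatedD[OF F(2) \<open>x \<in> F\<close>] by (intro r_step[OF x vis]) auto
        then show "g (S (int j) x) = 1"
          using r0 \<open>j < m\<close> by (simp add: g_def)
      qed
    next
      assume ones: "\<forall>j<m. g (S (int j) x) = 1"
      show "x \<in> F"
      proof (rule ccontr)
        assume "x \<notin> F"
        have vis: "visited x"
          using ones m(1) by (auto simp: g_def split: if_splits dest: spec[of _ 0])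
        \<comment> \<open>If the window of \<open>m\<close> times enters \<open>F\<close> after time
          \<open>0\<close>, it contains the zero just before the first entry. Otherwise the clock
          runs from \<open>r x > 0\<close> to \<open>r x + m - 1\<close>.\<close>
        show False
        proof (cases "\<exists>l. 1 \<le> l \<and> l < m \<and> S (int l) x \<in> F")
          case True
          define l where "l = (LEAST l. 1 \<le> l \<and> l < m \<and> S (int l) x \<in> F)"
          have l: "1 \<le> l \<and> l < m \<and> S (int l) x \<in> F"
            unfolding l_def using True by (rule LeastI_ex)
          have min: "S (int k) x \<notin> F" if "1 \<le> k" "k \<le> l - 1" for k
            using that l not_less_Least[of k "\<lambda>l. 1 \<le> l \<and> l < m \<and> S (int l) x \<in> F"]
            unfolding l_def[symmetric] by auto
          have step: "visited (S (int (l - 1)) x) \<and> r (S (int (l - 1)) x) = r x + (l - 1)"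
            using min by (intro r_step[OF x vis])
          have "m \<le> r x + (l - 1)"
            using gap[OF x vis, of l] l m by linarith
          moreover have "S 1 (S (int (l - 1)) x) \<in> F"
            using l x by (simp add: S_S of_nat_diff)
          ultimately have "g (S (int (l - 1)) x) = 0"
            using step by (simp add: g_def)
          then show False
            using ones l by (auto dest: spec[of _ "l - 1"])
        next
          case False
          then have step: "visited (S (int j) x) \<and> r (S (int j) x) = r x + j" if "j < m" for j
            using that by (intro r_step[OF x vis]) auto
          have "r x \<noteq> 0"
            using r_visit[OF vis] \<open>x \<notin> F\<close> by (metis S_0 minus_zero of_nat_0)
          \<comment> \<open>A clock starting below \<open>m\<close>, but not at \<open>0\<close>,
            reaches \<open>m\<close> within the window; one starting at \<open>m\<close> or later
            meets every residue modulo \<open>m\<close>, including \<open>t\<close>.\<close>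
          have "\<exists>j<m. r x + j = m \<or> m \<le> r x \<and> (r x + j) mod m = t"
          proof (cases "r x < m")
            case True
            then show ?thesis
              using \<open>r x \<noteq> 0\<close> by (intro exI[of _ "m - r x"]) auto
          next
            case r: False
            define q where "q = r x mod m"
            have "q < m"
              using m by (simp add: q_def)
            define j where "j = (if q \<le> t then t - q else m + t - q)"
            have "j < m" "q + j = t \<or> q + j = m + t"
              using \<open>q < m\<close> t(1) by (auto simp: j_def)
            moreover have "(r x + j) mod m = (q + j) mod m"
              by (simp add: q_def mod_simps)
            ultimately have "(r x + j) mod m = t"
              using t(1) by auto
            then show ?thesis
              using r \<open>j < m\<close> by auto
          qed
          then obtain j where j: "j < m" "r x + j = m \<or> m \<le> r x \<and> (r x + j) mod m = t"
            by blast
          then have "g (S (int j) x) = 0"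
            using step[OF j(1)] by (auto simp: g_def)
          then show False
            using ones j(1) by simp
        qed
      qed
    qed
  next
    \<comment> \<open>Up to a null set, \<open>f\<close> and \<open>g\<close> differ only on
      \<open>D t\<close> and where \<open>F\<close> is visited at one of the \<open>m + 2\<close>
      times \<open>-m\<close>, ..., \<open>0\<close>, \<open>1\<close>.\<close>
    define Y where "Y = {x \<in> space M. \<exists>k\<in>(\<lambda>k. - int k) ` {..m} \<union> {1}. S k x \<in> F}"
    have Y_sets [measurable]: "Y \<in> events"
      unfolding Y_def by measurable
    \<comment> \<open>A visit less than \<open>N\<close> steps away from
      \<open>S (- int N) x\<close>, in either direction, lies in the past of
      \<open>x\<close>.\<close>
    have "AE x in M. visited x"
      using AE_S[OF F(3), of "- int N"] AE_space
    proof eventually_elim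
      case (elim x)
      then obtain i where i: "\<bar>i\<bar> < int N" "S (i - int N) x \<in> F"
        by (auto simp: S_S)
      then have "S (- int (nat (int N - i))) x \<in> F"
        by (simp add: abs_less_iff)
      then show ?case
        using r_le by blast
    qed
    then have "AE x in M. x \<in> {x \<in> space M. f x \<noteq> g x} \<longrightarrow> x \<in> Y \<union> D t"
      using AE_space
    proof eventually_elim
      case (elim x)
      show ?case
      proof
        assume "x \<in> {x \<in> space M. f x \<noteq> g x}"
        then consider "r x \<le> m" | "r x mod m = t" | "S 1 x \<in> F"
          using elim(1) by (auto simp: g_def split: if_splits)
        then show "x \<in> Y \<union> D t"
          using r_visit[OF elim(1)] elim(2) by cases (auto simp: Y_def D_def)
      qed
    qed
    then have "prob {x \<in> space M. f x \<noteq> g x} \<le> prob (Y \<union> D t)"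
      by (rule finite_measure_mono_AE) simp
    also have "\<dots> \<le> prob Y + prob (D t)"
      by (rule measure_Un_le) auto
    also have "prob Y \<le> card ((\<lambda>k. - int k) ` {..m} \<union> {1}) * prob F"
      unfolding Y_def by (intro prob_visit_le) auto
    also have "\<dots> \<le> (m + 2) * (1 / N)"
    proof (intro mult_mono)
      have "card ((\<lambda>k. - int k) ` {..m} \<union> {1}) \<le> card ((\<lambda>k. - int k) ` {..m}) + 1"
        using card_Un_le[of "(\<lambda>k. - int k) ` {..m}" "{1}"] by simp
      also have "card ((\<lambda>k. - int k) ` {..m}) \<le> m + 1"
        using card_image_le[of "{..m}" "\<lambda>k. - int k"] by simp
      finally show "real (card ((\<lambda>k. - int k) ` {..m} \<union> {1})) \<le> real (m + 2)"
        by simp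
    qed (use prob_separated_le[OF F(1,2)] m in auto)
    finally show "prob {x \<in> space M. f x \<noteq> g x} \<le> (m + 2) / N + 1 / m"
      using t(2) by simp
  qed
qed

subsection \<open>Runs of ones as finitely determined events\<close>

definition runs :: "('a \<Rightarrow> real) \<Rightarrow> nat \<Rightarrow> int set \<Rightarrow> 'a set" where
  "runs f m K = {x \<in> space M. \<exists>k\<in>K. \<forall>j<m. f (S (k + int j) x) = 1}"

lemma runs_sets:
  assumes "f \<in> binary_funs M"
  shows "runs f m K \<in> events"
proof -
  have [measurable]: "f \<in> borel_measurable M"
    using assms by (auto simp: binary_funs_def)
  show ?thesis
    unfolding runs_def by measurable
qed

text \<open>With \<open>I\<close> the negative times or the times from \<open>n\<close> on, this
  places run events in the two sigma-algebras compared by the mixing coefficient.\<close>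

lemma runs_generated:
  assumes K: "finite K" and I: "\<And>k j. k \<in> K \<Longrightarrow> j < m \<Longrightarrow> k + int j \<in> I"
  shows "runs f m K \<in> generated_sigma M (orbit_process M T f) I"
proof -
  let ?G = "\<Union>i\<in>I. {orbit_process M T f i -` A \<inter> space M | A. A \<in> sets borel}"
  have "?G \<subseteq> Pow (space M)"
    by (rule UN_least) (rule subsetI, elim CollectE exE conjE, simp)
  then have G: "sigma_algebra (space M) (sigma_sets (space M) ?G)"
    by (rule sigma_algebra_sigma_sets)
  have *: "{x \<in> space M. f (S i x) = 1} \<in> sigma_sets (space M) ?G" if "i \<in> I" for i
  proof (rule sigma_sets.Basic)
    have "{x \<in> space M. f (S i x) = 1} = orbit_process M T f i -` {1} \<inter> space M"
      by (auto simp: orbit_process_def)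
    moreover have "{1::real} \<in> sets borel" by simp
    ultimately show "{x \<in> space M. f (S i x) = 1} \<in> ?G"
      by (intro UN_I[OF that]) (rule CollectI, intro exI conjI)
  qed
  have "{x \<in> space M. \<exists>k\<in>K. \<forall>j\<in>{..<m}. f (S (k + int j) x) = 1} \<in> sigma_sets (space M) ?G"
    using K I by (intro sigma_algebra.sets_Collect_countable_Ex'[OF G]
        sigma_algebra.sets_Collect_countable_All'[OF G] * countable_finite) simp_all
  then show ?thesis
    by (simp only: runs_def generated_sigma_def Ball_def lessThan_iff)
qed

section \<open>Dependence that survives small perturbations\<close>

lemma prob_diff_le:
  assumes [measurable]: "A \<in> events" "A' \<in> events" "D \<in> events" and eq: "A - D = A' - D"
  shows "\<bar>prob A - prob A'\<bar> \<le> prob D"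
proof -
  have "prob A \<le> prob (A' \<union> D)" "prob A' \<le> prob (A \<union> D)"
    using eq by (auto intro!: finite_measure_mono)
  moreover have "prob (A' \<union> D) \<le> prob A' + prob D" "prob (A \<union> D) \<le> prob A + prob D"
    by (auto intro!: measure_Un_le)
  ultimately show ?thesis by linarith
qed

text \<open>The run events read at most \<open>(card K + card L) * m\<close> coordinates. Off the
  set \<open>D\<close> where \<open>f\<close> and \<open>g\<close> disagree at one of them, the
  events coincide. The probability of the intersection thus moves by at most \<open>prob D\<close>,
  the product by at most twice that.\<close>

lemma dependence_runs_stable:
  fixes m :: nat
  assumes f: "f \<in> binary_funs M" and g: "g \<in> binary_funs M" and K: "finite K" "finite L"
  defines "dep \<equiv> \<lambda>h. prob (runs h m K \<inter> runs h m L) - prob (runs h m K) * prob (runs h m L)"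
  shows "\<bar>dep f - dep g\<bar> \<le> 3 * ((card K + card L) * m) * prob {x \<in> space M. f x \<noteq> g x}"
proof -
  have [measurable]: "f \<in> borel_measurable M" "g \<in> borel_measurable M"
    using f g by (auto simp: binary_funs_def)
  define I where "I = (\<lambda>(k, j). k + int j) ` ((K \<union> L) \<times> {..<m})"
  define D where "D = {x \<in> space M. \<exists>i\<in>I. S i x \<in> {x \<in> space M. f x \<noteq> g x}}"
  have fin: "finite I"
    using K by (auto simp: I_def)
  have "card I \<le> card ((K \<union> L) \<times> {..<m})"
    unfolding I_def using K by (intro card_image_le) auto
  also have "\<dots> \<le> (card K + card L) * m"
    by (simp add: card_cartesian_product card_Un_le)
  finally have card: "card I \<le> (card K + card L) * m" .
  have D_sets [measurable]: "D \<in> events"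
    unfolding D_def using fin by measurable
  have eq: "runs f m J - D = runs g m J - D" if "J \<subseteq> K \<union> L" for J
  proof -
    have "f (S (k + int j) x) = g (S (k + int j) x)"
      if "x \<in> space M" "x \<notin> D" "k \<in> J" "j < m" for x k j
    proof -
      have "k + int j \<in> I"
        using that \<open>J \<subseteq> K \<union> L\<close> by (auto simp: I_def)
      then show ?thesis
        using that by (auto simp: D_def)
    qed
    then have "(\<exists>k\<in>J. \<forall>j<m. f (S (k + int j) x) = 1) \<longleftrightarrow> (\<exists>k\<in>J. \<forall>j<m. g (S (k + int j) x) = 1)"
      if "x \<in> space M" "x \<notin> D" for x
      using that by simp
    then show ?thesis
      by (auto simp: runs_def)
  qed
  note [measurable] = runs_sets[OF f] runs_sets[OF g]
  have 1: "\<bar>prob (runs f m K) - prob (runs g m K)\<bar> \<le> prob D"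
    "\<bar>prob (runs f m L) - prob (runs g m L)\<bar> \<le> prob D"
    using eq by (auto intro!: prob_diff_le)
  have 2: "\<bar>prob (runs f m K \<inter> runs f m L) - prob (runs g m K \<inter> runs g m L)\<bar> \<le> prob D"
    using eq[of K] eq[of L] by (intro prob_diff_le) (auto simp: Diff_Int_distrib2)
  have 3: "\<bar>a * b - a' * b'\<bar> \<le> 2 * d"
    if "\<bar>a - a'\<bar> \<le> d" "\<bar>b - b'\<bar> \<le> d" "0 \<le> a'" "a' \<le> 1" "0 \<le> b" "b \<le> 1" for a b a' b' d :: real
  proof -
    have "\<bar>a * b - a' * b'\<bar> = \<bar>(a - a') * b + a' * (b - b')\<bar>"
      by (simp add: algebra_simps)
    also have "\<dots> \<le> \<bar>a - a'\<bar> * b + a' * \<bar>b - b'\<bar>"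
      using that by (metis abs_mult abs_of_nonneg abs_triangle_ineq)
    also have "\<dots> \<le> d * 1 + 1 * d"
      using that by (intro add_mono mult_mono) auto
    finally show ?thesis by simp
  qed
  have "\<bar>dep f - dep g\<bar> \<le> 3 * prob D"
    using 2 3[OF 1] unfolding dep_def by (smt (verit) measure_nonneg prob_le_1)
  also have "prob D \<le> card I * prob {x \<in> space M. f x \<noteq> g x}"
    unfolding D_def using fin by (intro prob_visit_le) auto
  also have "\<dots> \<le> ((card K + card L) * m) * prob {x \<in> space M. f x \<noteq> g x}"
    using card by (intro mult_right_mono) (auto simp del: of_nat_mult of_nat_add)
  finally show ?thesis by simp
qed

text \<open>A real \<open>Sup\<close> bounds the members only of a set bounded above; here
  \<open>1\<close> is a bound.\<close>

lemma alpha_ge: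
  assumes "f \<in> binary_funs M" "A \<in> generated_sigma M (orbit_process M T f) {i. i < 0}"
    "B \<in> generated_sigma M (orbit_process M T f) {i. int n \<le> i}"
  shows "\<bar>prob (A \<inter> B) - prob A * prob B\<bar> \<le> rosenblatt_alpha M (orbit_process M T f) n"
  unfolding rosenblatt_alpha_def
proof (rule cSup_upper)
  show "bdd_above {\<bar>prob (A \<inter> B) - prob A * prob B\<bar> | A B.
      A \<in> generated_sigma M (orbit_process M T f) {i. i < 0} \<and>
      B \<in> generated_sigma M (orbit_process M T f) {i. int n \<le> i}}"
  proof (rule bdd_aboveI)
    fix d assume "d \<in> {\<bar>prob (A \<inter> B) - prob A * prob B\<bar> | A B.
      A \<in> generated_sigma M (orbit_process M T f) {i. i < 0} \<and>
      B \<in> generated_sigma M (orbit_process M T f) {i. int n \<le> i}}"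
    then obtain A B where "d = \<bar>prob (A \<inter> B) - prob A * prob B\<bar>" by blast
    moreover have "prob A * prob B \<le> 1"
      by (intro mult_le_one) auto
    moreover have "0 \<le> prob A * prob B" "0 \<le> prob (A \<inter> B)" "prob (A \<inter> B) \<le> 1"
      by auto
    ultimately show "d \<le> 1" by linarith
  qed
qed (use assms in blast)

text \<open>The density step for Baire: arbitrarily close to \<open>f\<close> there is a whole ball
  with \<open>\<alpha>(n) \<ge> 1/128\<close>. Its centre \<open>g\<close> has dependence at least
  \<open>1/64\<close>, of which the perturbation loses at most half.\<close>

lemma strongly_dependent_approximation:
  assumes C: "countable C" "C \<subseteq> sets M"
      "\<And>x y. x \<in> space M \<Longrightarrow> y \<in> space M \<Longrightarrow> x \<noteq> y \<Longrightarrow> \<exists>U\<in>C. x \<in> U \<and> y \<notin> U"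
    and ap: "aperiodic M T" and f: "f \<in> binary_funs M" and e: "0 < \<epsilon>"
  obtains g \<delta> where "g \<in> binary_funs M" "prob {x \<in> space M. f x \<noteq> g x} < \<epsilon>" "0 < \<delta>"
    "\<And>h. h \<in> binary_funs M \<Longrightarrow> prob {x \<in> space M. h x \<noteq> g x} < \<delta> \<Longrightarrow>
       1 / 128 \<le> rosenblatt_alpha M (orbit_process M T h) n"
proof -
  \<comment> \<open>The error of \<open>encode_marker\<close> is halved: \<open>m\<close> gives
    \<open>1 / m < \<epsilon> / 2\<close>, and \<open>s0 \<le> N\<close> will give
    \<open>(m + 2) / N < \<epsilon> / 2\<close>.\<close>
  obtain m :: nat where m: "2 / \<epsilon> < m"
    using reals_Archimedean2 by blast
  have m0: "0 < m"
    using m e by (cases "m = 0") (auto simp: not_less[symmetric])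
  obtain s0 :: nat where s0: "2 * (m + 2) / \<epsilon> < s0"
    using reals_Archimedean2 by blast
  have "0 < 2 * (m + 2) / \<epsilon>"
    using e by simp
  then have s0_pos: "0 < real s0"
    using s0 by (rule less_trans)
  define s where "s = Max {s0, m, n}"
  have s: "s0 \<le> s" "m \<le> s" "n \<le> s"
    by (auto simp: s_def)
  define N where "N = 4 * s"
  have mN: "0 < N" "m < N"
    using s m0 by (auto simp: N_def)
  obtain F where F: "F \<in> events" "separated N F" "AE x in M. \<exists>i. \<bar>i\<bar> < int N \<and> S i x \<in> F"
    using marker_set[OF C ap mN(1)] by blast
  obtain g where g: "g \<in> binary_funs M"
      "\<And>x. x \<in> space M \<Longrightarrow> (\<forall>j<m. g (S (int j) x) = 1) \<longleftrightarrow> x \<in> F"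
      "prob {x \<in> space M. f x \<noteq> g x} \<le> (m + 2) / N + 1 / m"
    using encode_marker[OF F f m0 mN(2)] by blast
  have runs_g: "runs g m K = {x \<in> space M. \<exists>k\<in>K. S k x \<in> F}" for K
    using g(2)[OF S_space] by (auto simp: runs_def S_S add.commute)
  \<comment> \<open>Runs of length \<open>m\<close> starting in \<open>K\<close> end by time
    \<open>-1\<close>, those in \<open>L\<close> start at \<open>n\<close> or later. Every
    \<open>l - k\<close> lies between \<open>1\<close> and \<open>4 * s - 1 = N - 1\<close>, so no
    point visits \<open>F\<close> at a time in \<open>K\<close> and at one in
    \<open>L\<close>.\<close>
  define K L where "K = {- (2 * int s - 1)..- int m}" and "L = {int n..2 * int s}"
  have fin: "finite K" "finite L"
    by (auto simp: K_def L_def)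
  have cards: "s \<le> card K" "s \<le> card L"
    using s m0 by (auto simp: K_def L_def)
  have F_ge: "1 / 8 \<le> s * prob F"
    using prob_marker_ge[OF F(1,3) mN(1)] m0 s by (simp add: N_def field_simps)
  have prob_runs: "1 / 8 \<le> prob (runs g m J)"
    if "finite J" "s \<le> card J" "\<And>k l. k \<in> J \<Longrightarrow> l \<in> J \<Longrightarrow> k - l < int N" for J
  proof -
    have "1 / 8 \<le> s * prob F" by fact
    also have "\<dots> \<le> card J * prob F"
      using that by (intro mult_right_mono) auto
    also have "\<dots> = prob (runs g m J)"
      unfolding runs_g using prob_visit_separated[OF F(1,2) that(1,3)] by simp
    finally show ?thesis .
  qed
  have "1 / 8 * (1 / 8) \<le> prob (runs g m K) * prob (runs g m L)"
    using fin cards s m0 by (intro mult_mono prob_runs) (auto simp: K_def L_def N_def)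
  moreover have disj: "runs g m K \<inter> runs g m L = {}"
  proof -
    have False if x: "x \<in> space M" "S k x \<in> F" "S l x \<in> F" "k \<in> K" "l \<in> L" for x k l
    proof -
      have "S (l - k) (S k x) \<notin> F"
        using x m0 by (intro separatedD[OF F(2)]) (auto simp: K_def L_def N_def)
      then show False
        using x by (simp add: S_S)
    qed
    then show ?thesis
      by (auto simp: runs_g)
  qed
  ultimately have dep_g: "1 / 64 \<le> \<bar>prob (runs g m K \<inter> runs g m L) - prob (runs g m K) * prob (runs g m L)\<bar>"
    by simp
  \<comment> \<open>The Lipschitz constant of \<open>dependence_runs_stable\<close>, raised by
    \<open>1\<close> to be positive; within radius \<open>1 / (128 * c)\<close> the dependence
    changes by at most \<open>1 / 128\<close>.\<close>
  define c :: real where "c = 3 * ((card K + card L) * m) + 1"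
  have "0 < c" unfolding c_def by (subst of_nat_0_less_iff) simp
  show ?thesis
  proof
    show "g \<in> binary_funs M" by fact
    have "(m + 2) / N \<le> (m + 2) / s0"
      using s mN s0_pos by (intro divide_left_mono) (auto simp: N_def)
    also have "\<dots> < \<epsilon> / 2"
      using s0 s0_pos e by (simp add: field_simps)
    finally have "(m + 2) / N < \<epsilon> / 2" .
    moreover have "1 / m < \<epsilon> / 2"
      using m m0 e by (simp add: field_simps)
    ultimately show "prob {x \<in> space M. f x \<noteq> g x} < \<epsilon>"
      using g(3) by linarith
    show "0 < 1 / (128 * c)"
      using \<open>0 < c\<close> by simp
    fix h assume h: "h \<in> binary_funs M" "prob {x \<in> space M. h x \<noteq> g x} < 1 / (128 * c)"
    have "3 * ((card K + card L) * m) * prob {x \<in> space M. h x \<noteq> g x} \<le> c * (1 / (128 * c))"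
      using h(2) \<open>0 < c\<close> by (intro mult_mono) (auto simp: c_def)
    also have "\<dots> = 1 / 128"
      using \<open>0 < c\<close> by simp
    finally have "1 / 128 \<le> \<bar>prob (runs h m K \<inter> runs h m L) - prob (runs h m K) * prob (runs h m L)\<bar>"
      using dependence_runs_stable[OF h(1) g(1) fin, of m] dep_g by linarith
    also have "\<dots> \<le> rosenblatt_alpha M (orbit_process M T h) n"
      by (intro alpha_ge[OF h(1)] runs_generated fin) (auto simp: K_def L_def)
    finally show "1 / 128 \<le> rosenblatt_alpha M (orbit_process M T h) n" .
  qed
qed

end

subsection \<open>The complete metric space of binary functions\<close>

text \<open>A metrizable topology is T1, so a countable base separates points; its members are Borel
  and stay measurable in the completion.\<close>

lemma standard_prob_space_separating:
  assumes "standard_prob_space M"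
  obtains C where "countable C" "C \<subseteq> sets M"
    "\<And>x y. x \<in> space M \<Longrightarrow> y \<in> space M \<Longrightarrow> x \<noteq> y \<Longrightarrow> \<exists>U\<in>C. x \<in> U \<and> y \<notin> U"
proof -
  obtain N where N: "standard_borel N" and MN: "M = N \<or> M = completion N"
    using assms by (auto simp: standard_prob_space_def)
  then have sp: "space M = space N" and se: "sets N \<subseteq> sets M"
    by auto
  obtain X where X: "completely_metrizable_space X" "second_countable X" "topspace X = space N"
      and sN: "sets N = sigma_sets (space N) {U. openin X U}"
    using N by (auto simp: standard_borel_def)
  have T1: "t1_space X"
    using X(1) by (simp add: completely_metrizable_imp_metrizable_space metrizable_imp_t1_space)
  obtain C where C: "countable C" "\<forall>V\<in>C. openin X V"
      "\<forall>U x. openin X U \<and> x \<in> U \<longrightarrow> (\<exists>V\<in>C. x \<in> V \<and> V \<subseteq> U)"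
    using X(2) unfolding second_countable_def by (elim exE conjE) (rule that)
  show ?thesis
  proof
    show "C \<subseteq> sets M"
      using C(2) se by (auto simp: sN)
    fix x y assume "x \<in> space M" "y \<in> space M" "x \<noteq> y"
    then obtain U where "openin X U" "x \<in> U" "y \<notin> U"
      using T1 X(3) sp unfolding t1_space_def by metis
    then show "\<exists>U\<in>C. x \<in> U \<and> y \<notin> U"
      using C(3) by (metis subsetD)
  qed (fact C(1))
qed

context prob_space
begin

lemma binary_integrable:
  assumes "f \<in> binary_funs M"
  shows "integrable M f"
  using assms by (intro integrable_const_bound[of _ 1]) (fastforce simp: binary_funs_def)+

text \<open>The integrand is the indicator of the set of disagreement, which is the quantity in the
  perturbation bounds.\<close>

lemma binary_L1_dist:
  assumes "f \<in> binary_funs M" "g \<in> binary_funs M"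
  shows "(LINT x|M. \<bar>f x - g x\<bar>) = prob {x \<in> space M. f x \<noteq> g x}"
proof -
  have [measurable]: "f \<in> borel_measurable M" "g \<in> borel_measurable M"
    using assms by (auto simp: binary_funs_def)
  have "(LINT x|M. \<bar>f x - g x\<bar>) = (LINT x|M. indicator {x \<in> space M. f x \<noteq> g x} x)"
    using assms by (intro Bochner_Integration.integral_cong) (fastforce simp: binary_funs_def indicator_def)+
  also have "\<dots> = prob {x \<in> space M. f x \<noteq> g x}"
    by simp
  finally show ?thesis .
qed

lemma binary_class:
  assumes "f \<in> binary_funs M"
  obtains \<phi> where "\<phi> \<in> Z_space M" "f \<in> \<phi>"
proof
  show "ae_equal M `` {f} \<in> Z_space M"
    unfolding Z_space_def using assms by (rule quotientI)
  show "f \<in> ae_equal M `` {f}"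
    using equiv_class_self[OF equiv_ae_equal assms] .
qed

lemma Z_dist_prob:
  assumes "\<phi> \<in> Z_space M" "\<psi> \<in> Z_space M" "f \<in> \<phi>" "g \<in> \<psi>"
  shows "Z_dist M \<phi> \<psi> = prob {x \<in> space M. f x \<noteq> g x}"
proof -
  have "f \<in> binary_funs M" "g \<in> binary_funs M"
    using assms Z_space_some(2) by blast+
  then show ?thesis
    using assms by (simp add: Z_dist_class binary_L1_dist)
qed

text \<open>An \<open>L1\<close>-Cauchy sequence has an a.e. convergent subsequence, whose limit
  takes values in the closed set \<open>{0, 1}\<close>. Dominated convergence makes it an
  \<open>L1\<close> limit, and a Cauchy sequence converges along with its subsequence.\<close>

lemma Z_mcomplete: "Metric_space.mcomplete (Z_space M) (Z_dist M)"
proof -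
  interpret Z: Metric_space "Z_space M" "Z_dist M"
    by (rule Z_metric) unfold_locales
  show ?thesis
    unfolding Z.mcomplete_def
  proof (intro allI impI)
    fix \<sigma> assume \<sigma>: "Z.MCauchy \<sigma>"
    have \<sigma>Z: "\<sigma> n \<in> Z_space M" for n
      using \<sigma> by (auto simp: Z.MCauchy_def)
    define s where "s n = (SOME f. f \<in> \<sigma> n)" for n
    have s\<sigma>: "s n \<in> \<sigma> n" for n
      using Z_space_some(1)[OF \<sigma>Z] by (simp add: s_def)
    have sb: "s n \<in> binary_funs M" for n
      using s\<sigma> Z_space_some(2)[OF \<sigma>Z] by blast
    have [measurable]: "s n \<in> borel_measurable M" and s01: "x \<in> space M \<Longrightarrow> s n x \<in> {0, 1}" for n x
      using sb[of n] by (auto simp: binary_funs_def)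
    have "\<exists>N. \<forall>i\<ge>N. \<forall>j\<ge>N. (LINT x|M. norm (s i x - s j x)) < e" if "0 < e" for e
      using \<sigma> that Z_dist_class[OF \<sigma>Z \<sigma>Z s\<sigma> s\<sigma>] unfolding Z.MCauchy_def by simp
    then obtain r where r: "strict_mono r" and cau: "AE x in M. Cauchy (\<lambda>i. s (r i) x)"
      using cauchy_L1_AE_cauchy_subseq[of M s] binary_integrable[OF sb] by blast
    \<comment> \<open>Comparing the limit with \<open>1\<close> makes \<open>g\<close> binary
      everywhere, even where the subsequence diverges.\<close>
    define g where "g x = (if lim (\<lambda>i. s (r i) x) = 1 then 1 else (0::real))" for x
    have g_meas [measurable]: "g \<in> borel_measurable M"
      unfolding g_def[abs_def] by measurable
    have gb: "g \<in> binary_funs M"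
      by (auto simp: binary_funs_def g_def)
    have conv: "AE x in M. (\<lambda>i. \<bar>s (r i) x - g x\<bar>) \<longlonglongrightarrow> 0"
      using cau AE_space
    proof eventually_elim
      case (elim x)
      then have L: "(\<lambda>i. s (r i) x) \<longlonglongrightarrow> lim (\<lambda>i. s (r i) x)"
        by (simp add: Cauchy_convergent_iff convergent_LIMSEQ_iff)
      have "closed {0, 1 :: real}"
        by (simp add: finite_imp_closed)
      then have "lim (\<lambda>i. s (r i) x) \<in> {0, 1}"
        using s01[OF elim(2)] L by (meson closed_sequentially)
      then have "g x = lim (\<lambda>i. s (r i) x)"
        by (auto simp: g_def)
      then have "(\<lambda>i. s (r i) x - g x) \<longlonglongrightarrow> 0"
        using L by (simp add: LIM_zero)
      then show ?case
        by (rule tendsto_rabs_zero)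
    qed
    have int: "(\<lambda>i. LINT x|M. \<bar>s (r i) x - g x\<bar>) \<longlonglongrightarrow> (LINT x|M. 0)"
    proof (rule integral_dominated_convergence)
      show "AE x in M. norm \<bar>s (r i) x - g x\<bar> \<le> 1" for i
        using AE_space
      proof eventually_elim
        case (elim x)
        then show ?case using s01[OF elim, of "r i"] by (auto simp: g_def)
      qed
    qed (use conv in auto)
    obtain \<phi> where \<phi>: "\<phi> \<in> Z_space M" "g \<in> \<phi>"
      using binary_class[OF gb] .
    have "(\<lambda>i. Z_dist M ((\<sigma> \<circ> r) i) \<phi>) \<longlonglongrightarrow> 0"
      using int by (simp add: Z_dist_class[OF \<sigma>Z \<phi>(1) s\<sigma> \<phi>(2)])
    then have "limitin Z.mtopology (\<sigma> \<circ> r) \<phi> sequentially"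
      using \<phi>(1) \<sigma>Z by (simp add: Z.limitin_metric_dist_null)
    then show "\<exists>\<phi>. limitin Z.mtopology \<sigma> \<phi> sequentially"
      using Z.MCauchy_convergent_subsequence[OF \<sigma> r] by blast
  qed
qed

end

section \<open>The Baire category argument\<close>

theorem theorem1:
  fixes M :: "'a measure" and T :: "'a \<Rightarrow> 'a"
  assumes "standard_prob_space M"
    and "invertible_mpt M T"
    and "ergodic M T"
    and "aperiodic M T"
  shows "generic_in (Z_topology M)
           {\<phi> \<in> Z_space M. \<forall>f\<in>\<phi>. \<not> rosenblatt_mixing M (orbit_process M T f)}"
proof -
  interpret prob_space M
    using assms(1) by (simp add: standard_prob_space_def)
  interpret invertible_system M T
    by unfold_locales (fact assms(2))
  interpret Z: Metric_space "Z_space M" "Z_dist M"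
    by (rule Z_metric) unfold_locales
  let ?\<alpha> = "\<lambda>f. rosenblatt_alpha M (orbit_process M T f)"
  obtain C where C: "countable C" "C \<subseteq> sets M"
    "\<And>x y. x \<in> space M \<Longrightarrow> y \<in> space M \<Longrightarrow> x \<noteq> y \<Longrightarrow> \<exists>U\<in>C. x \<in> U \<and> y \<notin> U"
    using standard_prob_space_separating[OF assms(1)] by blast
  \<comment> \<open>Quantifying over all representatives avoids proving that
    \<open>?\<alpha>\<close> is constant on classes.\<close>
  define W where "W n = {\<phi> \<in> Z_space M. \<forall>f\<in>\<phi>. 1 / 128 \<le> ?\<alpha> f n}" for n
  define U where "U n = Z.mtopology interior_of W n" for n
  have U_open: "openin Z.mtopology (U n)" for n
    by (simp add: U_def)
  have U_dense: "Z.mtopology closure_of U n = Z_space M" for n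
  proof (rule equalityI)
    show "Z_space M \<subseteq> Z.mtopology closure_of U n"
      unfolding Z.metric_closure_of
    proof (intro subsetI CollectI conjI allI impI)
      fix \<phi> and \<epsilon> :: real assume \<phi>: "\<phi> \<in> Z_space M" and "0 < \<epsilon>"
      obtain f where f: "f \<in> \<phi>"
        using Z_space_some(1)[OF \<phi>] by blast
      have fb: "f \<in> binary_funs M"
        using f Z_space_some(2)[OF \<phi>] by blast
      obtain g \<delta> where g: "g \<in> binary_funs M" "prob {x \<in> space M. f x \<noteq> g x} < \<epsilon>" "0 < \<delta>"
          "\<And>h. h \<in> binary_funs M \<Longrightarrow> prob {x \<in> space M. h x \<noteq> g x} < \<delta> \<Longrightarrow> 1 / 128 \<le> ?\<alpha> h n"
        using strongly_dependent_approximation[OF C assms(4) fb \<open>0 < \<epsilon>\<close>] by blast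
      obtain \<psi> where \<psi>: "\<psi> \<in> Z_space M" "g \<in> \<psi>"
        using binary_class[OF g(1)] .
      \<comment> \<open>Transferring the perturbation bound to classes gives an open ball inside
        \<open>W n\<close>, hence inside its interior \<open>U n\<close>.\<close>
      have "Z.mball \<psi> \<delta> \<subseteq> W n"
      proof
        fix \<theta> assume "\<theta> \<in> Z.mball \<psi> \<delta>"
        then have \<theta>: "\<theta> \<in> Z_space M" "Z_dist M \<theta> \<psi> < \<delta>"
          by (auto simp: Z.commute)
        have "1 / 128 \<le> ?\<alpha> h n" if "h \<in> \<theta>" for h
        proof (rule g(4))
          show "h \<in> binary_funs M"
            using that Z_space_some(2)[OF \<theta>(1)] by blast
          show "prob {x \<in> space M. h x \<noteq> g x} < \<delta>"
            using \<theta>(2) Z_dist_prob[OF \<theta>(1) \<psi>(1) that \<psi>(2)] by simp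
        qed
        then show "\<theta> \<in> W n"
          using \<theta>(1) by (simp add: W_def)
      qed
      then have "Z.mball \<psi> \<delta> \<subseteq> U n"
        unfolding U_def by (intro interior_of_maximal Z.openin_mball)
      then have "\<psi> \<in> U n"
        using \<psi>(1) g(3) by auto
      moreover have "\<psi> \<in> Z.mball \<phi> \<epsilon>"
        using \<phi> \<psi> g(2) Z_dist_prob[OF \<phi> \<psi>(1) f \<psi>(2)] by simp
      ultimately show "\<exists>\<psi>\<in>U n. \<psi> \<in> Z.mball \<phi> \<epsilon>"
        by blast
    qed
  qed (use closure_of_subset_topspace[of Z.mtopology] in simp)
  have "(\<Inter>n. U n) \<subseteq> {\<phi> \<in> Z_space M. \<forall>f\<in>\<phi>. \<not> rosenblatt_mixing M (orbit_process M T f)}"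
  proof
    fix \<phi> assume "\<phi> \<in> (\<Inter>n. U n)"
    then have \<phi>W: "\<phi> \<in> W n" for n
      using interior_of_subset[of Z.mtopology "W n"] by (auto simp: U_def)
    have "\<not> rosenblatt_mixing M (orbit_process M T f)" if "f \<in> \<phi>" for f
    proof
      assume "rosenblatt_mixing M (orbit_process M T f)"
      then have "(1::real) / 128 \<le> 0"
        unfolding rosenblatt_mixing_def
        by (rule LIMSEQ_le_const) (use \<phi>W that in \<open>auto simp: W_def\<close>)
      then show False by simp
    qed
    then show "\<phi> \<in> {\<phi> \<in> Z_space M. \<forall>f\<in>\<phi>. \<not> rosenblatt_mixing M (orbit_process M T f)}"
      using \<phi>W by (simp add: W_def)
  qed
  moreover have "gdelta_in Z.mtopology (\<Inter>n. U n)"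
    using U_open by (intro gdelta_in_Inter) (auto intro: open_imp_gdelta_in)
  moreover have "Z.mtopology closure_of (\<Inter>n. U n) = topspace Z.mtopology"
    using Z.metric_Baire_category[OF Z_mcomplete, of "range U"] U_open U_dense by auto
  ultimately show ?thesis
    unfolding generic_in_def Z_topology_def by blast
qed

end
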